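(* Let $N, n\geq 1$ be integers and let $\mathcal M = \{A_1,\dotsc,A_N\}$ be an indexed family of real $n\times n$ matrices. For each integer $m\geq 1$ define \[ \ell_m(\mathcal M) = \sup\left\{\rho\left(\frac1N\sum_{i=1}^N W_i\otimes A_i\right) : \mathcal W = \{W_1,\dotsc,W_N\}\in(\mathbb R^{m\times m})^N,\ \rho_\infty(\mathcal W)=1\right\}. \] The following statements are true: 1. Suppose $\rho_\infty(\mathcal M)>0$ and let \[ \ell_{\mathrm Z}(\mathcal M) = \frac{\rho\left(\sum_{i=1}^N A_i\otimes A_i\right)}{N\,\rho_\infty(\mathcal M)}. \] If $m\geq n$, then $\ell_m(\mathcal M)\geq \ell_{\mathrm Z}(\mathcal M)$. 2. Define \[ \ell_{[-1,1]}(\mathcal M) = \max_{w_1,\dotsc,w_N\in[-1,1]}\rho\left(\frac1N\sum_{i=1}^N w_iA_i\right). \] Then $\ell_{[-1,1]}(\mathcal M)\leq \ell_m(\mathcal M)$ for every $m\geq 1$.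
   Context: $\lVert \cdot\rVert$ denotes the maximum singular value of a matrix, $\rho(\cdot)$ the spectral radius of a square matrix, and $\otimes$ the Kronecker product. Indexed families may contain repeated matrices. The joint spectral radius of an indexed family $\mathcal W=\{W_1,\dotsc,W_N\}$ of square matrices of the same size is \[ \rho_\infty(\mathcal W) = \limsup_{k\to\infty}\ \max_{i_1,\dotsc,i_k\in\{1,\dotsc,N\}} \lVert W_{i_k}\dotsm W_{i_1}\rVert^{1/k}. \] *)

theory Defs
  imports
    "Jordan_Normal_Form.Spectral_Radius"
    "HOL-Library.Extended_Real"
    "HOL-Library.Liminf_Limsup"
begin

text \<open>A family of matrices indexed by \<open>1, \<dots>, N\<close> is a function on the naturals of
  which only the values on \<open>{1..N}\<close> matter.\<close>

definition mat_family :: "nat \<Rightarrow> nat \<Rightarrow> (nat \<Rightarrow> real mat) \<Rightarrow> bool" where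
  "mat_family N d W \<longleftrightarrow> (\<forall>i\<in>{1..N}. W i \<in> carrier_mat d d)"

text \<open>Matrices of varying size form no additive monoid, so the big operator does not
  apply to them. The dimension is an explicit parameter of the sum.\<close>

definition mat_sum :: "nat \<Rightarrow> (nat \<Rightarrow> real mat) \<Rightarrow> nat set \<Rightarrow> real mat" where
  "mat_sum d f I = mat d d (\<lambda>(r, c). \<Sum>i\<in>I. f i $$ (r, c))"

definition kronecker :: "real mat \<Rightarrow> real mat \<Rightarrow> real mat" where
  "kronecker A B = mat (dim_row A * dim_row B) (dim_col A * dim_col B)
     (\<lambda>(r, c). A $$ (r div dim_row B, c div dim_col B) * B $$ (r mod dim_row B, c mod dim_col B))"

definition rho :: "real mat \<Rightarrow> real" where
  "rho A = spectral_radius (map_mat complex_of_real A)"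

definition singular_values :: "real mat \<Rightarrow> real set" where
  "singular_values A = sqrt ` spectrum (transpose_mat A * A)"

definition max_singular_value :: "real mat \<Rightarrow> real" where
  "max_singular_value A = Max (singular_values A)"

text \<open>The list \<open>[i\<^sub>1, \<dots>, i\<^sub>k]\<close> is sent to \<open>W i\<^sub>k * \<dots> * W i\<^sub>1\<close>.\<close>

fun word_prod :: "nat \<Rightarrow> (nat \<Rightarrow> real mat) \<Rightarrow> nat list \<Rightarrow> real mat" where
  "word_prod d W [] = 1\<^sub>m d"
| "word_prod d W (i # is) = word_prod d W is * W i"

text \<open>Extended reals make the limit superior meaningful without a prior boundedness
  argument. The term for \<open>k = 0\<close> (where \<open>root 0 x = 0\<close>) has no influence on it.\<close>

definition joint_spectral_radius :: "nat \<Rightarrow> nat \<Rightarrow> (nat \<Rightarrow> real mat) \<Rightarrow> ereal" where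
  "joint_spectral_radius N d W =
     limsup (\<lambda>k. ereal (Max {root k (max_singular_value (word_prod d W is)) | is.
                               length is = k \<and> set is \<subseteq> {1..N}}))"

definition ell :: "nat \<Rightarrow> nat \<Rightarrow> (nat \<Rightarrow> real mat) \<Rightarrow> nat \<Rightarrow> ereal" where
  "ell N n A m =
     Sup {ereal (rho ((1 / real N) \<cdot>\<^sub>m mat_sum (m * n) (\<lambda>i. kronecker (W i) (A i)) {1..N})) | W.
            mat_family N m W \<and> joint_spectral_radius N m W = 1}"

definition ell_Z :: "nat \<Rightarrow> nat \<Rightarrow> (nat \<Rightarrow> real mat) \<Rightarrow> ereal" where
  "ell_Z N n A =
     ereal (rho (mat_sum (n * n) (\<lambda>i. kronecker (A i) (A i)) {1..N}))
       / (ereal (real N) * joint_spectral_radius N n A)"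

text \<open>\<open>GREATEST\<close> denotes an actual maximum: it is specified only if the set has a
  largest element.\<close>

definition ell_box :: "nat \<Rightarrow> nat \<Rightarrow> (nat \<Rightarrow> real mat) \<Rightarrow> real" where
  "ell_box N n A =
     (GREATEST x. \<exists>w :: nat \<Rightarrow> real. (\<forall>i\<in>{1..N}. w i \<in> {-1..1}) \<and>
        x = rho ((1 / real N) \<cdot>\<^sub>m mat_sum n (\<lambda>i. w i \<cdot>\<^sub>m A i) {1..N}))"

end

theory Submission
  imports Defs "HOL-Analysis.Function_Topology"
begin

text \<open>Padding the \<open>W\<^sub>i\<close> with zero rows and columns leaves the joint spectral radius unchanged and pads
  \<open>\<Sum>i. W\<^sub>i \<otimes> A\<^sub>i\<close> with zeros, so \<open>\<ell>\<^sub>m\<close> is nondecreasing in \<open>m\<close>. It then suffices to bound \<open>\<ell>\<^sub>n\<close> from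
  below by the choice \<open>W\<^sub>i = A\<^sub>i / \<rho>\<^sub>\<infinity>\<close>, and \<open>\<ell>\<^sub>1\<close> by the scalars \<open>w\<^sub>i / max\<^sub>j \<bar>w\<^sub>j\<bar>\<close>, where \<open>w\<close> is a maximizer
  over the box.\<close>

section \<open>Spectra\<close>

lemma rho_ge:
  assumes "A \<in> carrier_mat d d" "eigenvalue (map_mat complex_of_real A) e"
  shows "cmod e \<le> rho A"
proof -
  let ?A = "map_mat complex_of_real A"
  have A: "?A \<in> carrier_mat d d" using assms by simp
  have "d > 0" using eigenvalue_imp_nonzero_dim[OF A assms(2)] .
  from spectral_radius_mem_max(2)[OF A this, of "cmod e"] assms(2) show ?thesis
    unfolding rho_def spectrum_def by auto
qed

lemma rho_attained:
  assumes "A \<in> carrier_mat d d" "d > 0"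
  obtains e where "eigenvalue (map_mat complex_of_real A) e" "cmod e = rho A"
proof -
  have A: "map_mat complex_of_real A \<in> carrier_mat d d" using assms by simp
  from spectral_radius_mem_max(1)[OF A assms(2)] that show thesis
    unfolding rho_def spectrum_def by auto
qed

lemma rho_nonneg:
  assumes "A \<in> carrier_mat d d" "d > 0"
  shows "0 \<le> rho A"
proof -
  obtain e where "cmod e = rho A" using rho_attained[OF assms] by blast
  then show ?thesis by (metis norm_ge_zero)
qed

lemma eigenvalue_smult:
  fixes A :: "'a :: field mat"
  assumes "A \<in> carrier_mat d d" "c \<noteq> 0"
  shows "eigenvalue (c \<cdot>\<^sub>m A) e \<longleftrightarrow> eigenvalue A (e / c)"
proof -
  have "char_matrix (c \<cdot>\<^sub>m A) e = c \<cdot>\<^sub>m char_matrix A (e / c)"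
    unfolding char_matrix_def using assms by (intro eq_matI) (auto simp: field_simps)
  then have "det (char_matrix (c \<cdot>\<^sub>m A) e) = c ^ d * det (char_matrix A (e / c))"
    using char_matrix_closed[OF assms(1), of "e / c"] by auto
  moreover have "c \<cdot>\<^sub>m A \<in> carrier_mat d d" using assms by simp
  ultimately show ?thesis using assms(2) by (simp add: eigenvalue_det[OF assms(1)] eigenvalue_det[of _ d])
qed

lemma rho_smult:
  assumes A: "A \<in> carrier_mat d d" and d: "d > 0" and c: "c > 0"
  shows "rho (c \<cdot>\<^sub>m A) = c * rho A"
proof -
  let ?C = "map_mat complex_of_real"
  have hom: "?C (c \<cdot>\<^sub>m A) = complex_of_real c \<cdot>\<^sub>m ?C A"
    by (intro eq_matI) auto
  have ev: "eigenvalue (?C (c \<cdot>\<^sub>m A)) e \<longleftrightarrow> eigenvalue (?C A) (e / of_real c)" for e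
    unfolding hom by (rule eigenvalue_smult[of _ d]) (use A c in auto)
  have cA: "c \<cdot>\<^sub>m A \<in> carrier_mat d d" using A by simp
  obtain e where e: "eigenvalue (?C (c \<cdot>\<^sub>m A)) e" "cmod e = rho (c \<cdot>\<^sub>m A)"
    using rho_attained[OF cA d] .
  obtain f where f: "eigenvalue (?C A) f" "cmod f = rho A"
    using rho_attained[OF A d] .
  have "rho (c \<cdot>\<^sub>m A) / c \<le> rho A"
    using rho_ge[OF A e(1)[unfolded ev]] e(2) c by (simp add: norm_divide)
  moreover have "c * rho A \<le> rho (c \<cdot>\<^sub>m A)"
    using rho_ge[OF cA, of "of_real c * f"] f c by (simp add: ev norm_mult)
  ultimately show ?thesis using c by (simp add: field_simps)
qed

text \<open>Reading \<open>A *\<^sub>v v = e \<cdot>\<^sub>v v\<close> at a coordinate where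
  \<open>v\<close> has maximal modulus bounds \<open>e\<close> by the sum of the moduli in one row.
  This confines the eigenvalues of a family with bounded entries to a common compact set.\<close>

lemma eigenvalue_norm_le:
  fixes A :: "complex mat"
  assumes A: "A \<in> carrier_mat d d" and b: "\<And>i j. i < d \<Longrightarrow> j < d \<Longrightarrow> cmod (A $$ (i, j)) \<le> b"
    and e: "eigenvalue A e"
  shows "cmod e \<le> real d * b"
proof -
  obtain v where v: "v \<in> carrier_vec d" "v \<noteq> 0\<^sub>v d" "A *\<^sub>v v = e \<cdot>\<^sub>v v"
    using e A unfolding eigenvalue_def eigenvector_def by auto
  have d: "d > 0" using eigenvalue_imp_nonzero_dim[OF A e] .
  obtain k where k: "k < d" "\<And>j. j < d \<Longrightarrow> cmod (v $ j) \<le> cmod (v $ k)"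
  proof -
    have "Max ((\<lambda>j. cmod (v $ j)) ` {..<d}) \<in> (\<lambda>j. cmod (v $ j)) ` {..<d}"
      using d by (intro Max_in) auto
    then obtain k where "k < d" "Max ((\<lambda>j. cmod (v $ j)) ` {..<d}) = cmod (v $ k)" by auto
    then show thesis
      by (intro that[of k]) (auto simp flip: \<open>Max _ = _\<close>)
  qed
  have pos: "cmod (v $ k) > 0"
  proof (rule ccontr)
    assume "\<not> ?thesis"
    then have "v $ j = 0" if "j < d" for j using k(2)[OF that] by simp
    then have "v = 0\<^sub>v d" using v(1) by (intro eq_vecI) auto
    with v(2) show False ..
  qed
  have "e * v $ k = (\<Sum>j<d. A $$ (k, j) * v $ j)"
    using arg_cong[OF v(3), of "\<lambda>u. u $ k"] A v(1) k(1)
    by (simp add: scalar_prod_def lessThan_atLeast0)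
  then have "cmod e * cmod (v $ k) \<le> (\<Sum>j<d. cmod (A $$ (k, j) * v $ j))"
    by (metis norm_mult norm_sum)
  also have "\<dots> \<le> (\<Sum>j<d. b * cmod (v $ k))"
    using k b by (intro sum_mono) (simp add: norm_mult mult_mono')
  finally show ?thesis using pos by simp
qed

section \<open>Singular values\<close>

lemma real_mat_conjugate_vec:
  assumes "A \<in> carrier_mat r c" "v \<in> carrier_vec c"
  shows "map_mat complex_of_real A *\<^sub>v conjugate v = conjugate (map_mat complex_of_real A *\<^sub>v v)"
  using assms by (intro eq_vecI) (auto simp: scalar_prod_def)

text \<open>For a real matrix the transpose is the adjoint, so an eigenvector \<open>v\<close> gives
  \<open>e\<close> times the squared norm of \<open>v\<close> as the squared norm of the image of
  \<open>v\<close>.\<close>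

lemma eigenvalue_gram:
  assumes A: "A \<in> carrier_mat d d"
    and e: "eigenvalue (map_mat complex_of_real (transpose_mat A * A)) e"
  shows "\<exists>x\<ge>0. e = complex_of_real x"
proof -
  let ?A = "map_mat complex_of_real A"
  have cA: "?A \<in> carrier_mat d d" using A by simp
  have hom: "map_mat complex_of_real (transpose_mat A * A) = transpose_mat ?A * ?A"
    using A by (intro eq_matI) (auto simp: scalar_prod_def)
  obtain v where v: "v \<in> carrier_vec d" "v \<noteq> 0\<^sub>v d" "(transpose_mat ?A * ?A) *\<^sub>v v = e \<cdot>\<^sub>v v"
    using e A unfolding eigenvalue_def eigenvector_def hom by auto
  have Av: "?A *\<^sub>v v \<in> carrier_vec d" using cA v(1) by simp
  have "e * (v \<bullet>c v) = ((transpose_mat ?A * ?A) *\<^sub>v v) \<bullet>c v"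
    using v by simp
  also have "\<dots> = (transpose_mat ?A *\<^sub>v (?A *\<^sub>v v)) \<bullet>c v"
    using cA v(1) by simp
  also have "\<dots> = (?A *\<^sub>v v) \<bullet> (?A *\<^sub>v conjugate v)"
    using transpose_vec_mult_scalar[OF cA _ Av, of "conjugate v"] v(1)
    by (metis carrier_vec_conjugate)
  also have "\<dots> = (?A *\<^sub>v v) \<bullet>c (?A *\<^sub>v v)"
    using real_mat_conjugate_vec[OF A v(1)] by simp
  finally have eq: "e * (v \<bullet>c v) = (?A *\<^sub>v v) \<bullet>c (?A *\<^sub>v v)" .
  \<comment> \<open>The order on the complex numbers compares only numbers with equal imaginary
    parts, so this inequality and the one for the image vector also say that both products are
    real.\<close>
  have "v \<bullet>c v > 0" using v by simp
  then obtain a where a: "v \<bullet>c v = complex_of_real a" "a > 0"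
    by (metis complex_eq_iff complex_of_real_def less_complex_def zero_complex.simps complex.sel)
  have "(?A *\<^sub>v v) \<bullet>c (?A *\<^sub>v v) \<ge> 0" by blast
  then obtain b where b: "(?A *\<^sub>v v) \<bullet>c (?A *\<^sub>v v) = complex_of_real b" "b \<ge> 0"
    by (metis complex_eq_iff less_eq_complex_def zero_complex.simps Re_complex_of_real Im_complex_of_real)
  from eq a b have "e = complex_of_real (b / a)" by (simp add: field_simps)
  with a b show ?thesis by (intro exI[of _ "b / a"]) auto
qed

lemma eigenvalue_of_real_iff:
  assumes "A \<in> carrier_mat d d"
  shows "eigenvalue (map_mat complex_of_real A) (of_real x) \<longleftrightarrow> eigenvalue A x"
proof -
  have "char_matrix (map_mat complex_of_real A) (of_real x) = map_mat of_real (char_matrix A x)"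
    unfolding char_matrix_def using assms by (intro eq_matI) auto
  then show ?thesis using assms by (simp add: eigenvalue_det[of _ d])
qed

text \<open>A real matrix may have an empty real spectrum. The Gram matrix does not: it has a
  complex eigenvalue, which is real by \<open>eigenvalue_gram\<close>. Hence the \<open>Max\<close>
  in \<open>max_singular_value\<close> is over a finite nonempty set.\<close>

lemma spectrum_gram:
  fixes A :: "real mat"
  assumes A: "A \<in> carrier_mat d d" and d: "d > 0"
  shows "finite (spectrum (transpose_mat A * A))" "spectrum (transpose_mat A * A) \<noteq> {}"
    "\<And>x. x \<in> spectrum (transpose_mat A * A) \<Longrightarrow> 0 \<le> x"
proof -
  let ?G = "transpose_mat A * A"
  have G: "?G \<in> carrier_mat d d" using A by simp
  show "finite (spectrum ?G)" using card_finite_spectrum(1)[OF G] .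
  have "map_mat complex_of_real ?G \<in> carrier_mat d d" using G by simp
  from spectrum_non_empty[OF this d] obtain e where e: "eigenvalue (map_mat complex_of_real ?G) e"
    unfolding spectrum_def by auto
  then obtain x where "e = complex_of_real x" using eigenvalue_gram[OF A] by blast
  then show "spectrum ?G \<noteq> {}"
    using e eigenvalue_of_real_iff[OF G] unfolding spectrum_def by auto
  fix x assume "x \<in> spectrum ?G"
  then have "eigenvalue (map_mat complex_of_real ?G) (of_real x)"
    unfolding eigenvalue_of_real_iff[OF G] spectrum_def by simp
  from eigenvalue_gram[OF A this] show "0 \<le> x" by auto
qed

lemma singular_values_props:
  assumes "A \<in> carrier_mat d d" "d > 0"
  shows "finite (singular_values A)" "singular_values A \<noteq> {}" "\<And>s. s \<in> singular_values A \<Longrightarrow> 0 \<le> s"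
  using spectrum_gram[OF assms] unfolding singular_values_def by auto

text \<open>The Gram matrix scales by \<open>c\<^sup>2\<close>, so each singular value scales by
  \<open>c\<close>, and the monotone map commutes with \<open>Max\<close>.\<close>

lemma max_singular_value_smult:
  assumes A: "A \<in> carrier_mat d d" and d: "d > 0" and c: "c > 0"
  shows "max_singular_value (c \<cdot>\<^sub>m A) = c * max_singular_value A"
proof -
  let ?G = "transpose_mat A * A"
  have G: "?G \<in> carrier_mat d d" using A by simp
  have gram: "transpose_mat (c \<cdot>\<^sub>m A) * (c \<cdot>\<^sub>m A) = c\<^sup>2 \<cdot>\<^sub>m ?G"
    using A by (intro eq_matI) (auto simp: scalar_prod_def sum_distrib_left power2_eq_square ac_simps)
  have "spectrum (c\<^sup>2 \<cdot>\<^sub>m ?G) = (*) (c\<^sup>2) ` spectrum ?G"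
  proof (intro equalityI subsetI)
    fix e assume "e \<in> spectrum (c\<^sup>2 \<cdot>\<^sub>m ?G)"
    then have "e / c\<^sup>2 \<in> spectrum ?G" using eigenvalue_smult[OF G, of "c\<^sup>2" e] c by (simp add: spectrum_def)
    then show "e \<in> (*) (c\<^sup>2) ` spectrum ?G" using c by (intro image_eqI[of _ _ "e / c\<^sup>2"]) auto
  next
    fix e assume "e \<in> (*) (c\<^sup>2) ` spectrum ?G"
    then show "e \<in> spectrum (c\<^sup>2 \<cdot>\<^sub>m ?G)"
      using eigenvalue_smult[OF G, of "c\<^sup>2" e] c by (auto simp: spectrum_def)
  qed
  then have "singular_values (c \<cdot>\<^sub>m A) = (*) c ` singular_values A"
    unfolding singular_values_def gram using c by (auto simp: image_image real_sqrt_mult)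
  moreover have "mono ((*) c)" using c by (simp add: mono_def)
  ultimately show ?thesis
    unfolding max_singular_value_def
    using singular_values_props(1,2)[OF A d] by (simp add: mono_Max_commute)
qed


section \<open>Zero padding\<close>

text \<open>The parameter \<open>k\<close> counts the added rows and columns; it is not the new
  size. The entry type is general because the padding is applied to real matrices and to their
  complex images.\<close>

definition zero_pad :: "nat \<Rightarrow> 'a :: zero mat \<Rightarrow> 'a mat" where
  "zero_pad k A = four_block_mat A (0\<^sub>m (dim_row A) k) (0\<^sub>m k (dim_col A)) (0\<^sub>m k k)"

lemma zero_pad_carrier [simp]: "A \<in> carrier_mat d d \<Longrightarrow> zero_pad k A \<in> carrier_mat (d + k) (d + k)"
  unfolding zero_pad_def by auto

lemma index_zero_pad:
  assumes "A \<in> carrier_mat d d" "r < d + k" "c < d + k"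
  shows "zero_pad k A $$ (r, c) = (if r < d \<and> c < d then A $$ (r, c) else 0)"
  using assms unfolding zero_pad_def by auto

lemma zero_pad_mult:
  fixes A B :: "'a :: semiring_0 mat"
  assumes "A \<in> carrier_mat d d" "B \<in> carrier_mat d d"
  shows "zero_pad k A * zero_pad k B = zero_pad k (A * B)"
proof -
  have "zero_pad k A * zero_pad k B
    = four_block_mat (A * B + 0\<^sub>m d k * 0\<^sub>m k d) (A * 0\<^sub>m d k + 0\<^sub>m d k * 0\<^sub>m k k)
        (0\<^sub>m k d * B + 0\<^sub>m k k * 0\<^sub>m k d) (0\<^sub>m k d * 0\<^sub>m d k + 0\<^sub>m k k * 0\<^sub>m k k)"
    unfolding zero_pad_def using assms by (subst mult_four_block_mat[of _ d d _ k _ k]) auto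
  also have "\<dots> = zero_pad k (A * B)"
    unfolding zero_pad_def using assms by auto
  finally show ?thesis .
qed

lemma transpose_zero_pad: "transpose_mat (zero_pad k A) = zero_pad k (transpose_mat A)"
  unfolding zero_pad_def by (subst transpose_four_block_mat) auto

text \<open>The characteristic matrix is block diagonal with second block
  \<open>(- e) \<cdot>\<^sub>m 1\<^sub>m k\<close>, whose determinant vanishes exactly if
  \<open>e = 0\<close> and \<open>k > 0\<close>.\<close>

lemma eigenvalue_zero_pad:
  fixes A :: "'a :: field mat"
  assumes A: "A \<in> carrier_mat d d"
  shows "eigenvalue (zero_pad k A) e \<longleftrightarrow> eigenvalue A e \<or> (e = 0 \<and> k > 0)"
proof -
  have "char_matrix (zero_pad k A) e
    = four_block_mat (char_matrix A e) (0\<^sub>m d k) (0\<^sub>m k d) ((- e) \<cdot>\<^sub>m 1\<^sub>m k)"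
    unfolding char_matrix_def zero_pad_def using A by (intro eq_matI) auto
  also have "det \<dots> = det (char_matrix A e) * det ((- e) \<cdot>\<^sub>m 1\<^sub>m k)"
    using A by (intro det_four_block_mat_lower_left_zero[of _ d _ k]) auto
  finally show ?thesis
    using A by (auto simp: eigenvalue_det[OF A] eigenvalue_det[OF zero_pad_carrier[OF A]])
qed

lemma rho_le_rho_zero_pad:
  assumes A: "A \<in> carrier_mat d d" and d: "d > 0"
  shows "rho A \<le> rho (zero_pad k A)"
proof -
  have hom: "map_mat complex_of_real (zero_pad k A) = zero_pad k (map_mat complex_of_real A)"
    unfolding zero_pad_def using A by (intro eq_matI) auto
  obtain e where e: "eigenvalue (map_mat complex_of_real A) e" "cmod e = rho A"
    using rho_attained[OF A d] .
  have "eigenvalue (map_mat complex_of_real (zero_pad k A)) e"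
    unfolding hom using A e(1) by (subst eigenvalue_zero_pad[of _ d]) auto
  from rho_ge[OF zero_pad_carrier[OF A] this] e(2) show ?thesis by simp
qed

text \<open>Padding commutes with forming the Gram matrix, so it adds at most the singular value 0,
  which cannot change the maximum of a nonempty set of nonnegative numbers.\<close>

lemma max_singular_value_zero_pad:
  assumes A: "A \<in> carrier_mat d d" and d: "d > 0"
  shows "max_singular_value (zero_pad k A) = max_singular_value A"
proof -
  have "transpose_mat (zero_pad k A) * zero_pad k A = zero_pad k (transpose_mat A * A)"
    using A by (simp add: transpose_zero_pad zero_pad_mult[of _ d])
  moreover have "spectrum (zero_pad k (transpose_mat A * A))
    = spectrum (transpose_mat A * A) \<union> (if k > 0 then {0} else {})"
    using A by (auto simp: spectrum_def eigenvalue_zero_pad[of _ d])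
  ultimately have sv: "singular_values (zero_pad k A)
    = singular_values A \<union> (if k > 0 then {0} else {})"
    unfolding singular_values_def by auto
  note props = singular_values_props[OF A d]
  have "Max (insert 0 (singular_values A)) = Max (singular_values A)"
    using props Max_in[OF props(1,2)] by (simp add: max_absorb2)
  then show ?thesis unfolding max_singular_value_def sv by (simp add: Un_commute)
qed

lemma max_singular_value_1x1: "max_singular_value (mat 1 1 (\<lambda>_. x)) = \<bar>x\<bar>"
proof -
  let ?G = "transpose_mat (mat 1 1 (\<lambda>_. x)) * mat 1 1 (\<lambda>_. x)"
  have G: "?G \<in> carrier_mat 1 1" by (intro mult_carrier_mat[of _ 1 1]) simp_all
  have "det (char_matrix ?G e) = x * x - e" for e
    unfolding char_matrix_def by (subst det_single) (auto simp: scalar_prod_def)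
  then have "spectrum ?G = {x * x}"
    unfolding spectrum_def eigenvalue_det[OF G] by auto
  then show ?thesis unfolding max_singular_value_def singular_values_def by simp
qed

section \<open>The joint spectral radius\<close>

definition words :: "nat \<Rightarrow> nat \<Rightarrow> nat list set" where
  "words N k = {is. length is = k \<and> set is \<subseteq> {1..N}}"

lemma finite_words: "finite (words N k)"
  unfolding words_def using finite_lists_length_eq[of "{1..N}" k] by (simp add: conj_commute)

lemma words_nonempty:
  assumes "N \<ge> 1"
  shows "words N k \<noteq> {}"
proof -
  have "replicate k 1 \<in> words N k" using assms by (auto simp: words_def)
  then show ?thesis by blast
qed

lemma joint_spectral_radius_words:
  "joint_spectral_radius N d W
    = limsup (\<lambda>k. ereal (MAX is\<in>words N k. root k (max_singular_value (word_prod d W is))))"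
  unfolding joint_spectral_radius_def words_def image_Collect ..

lemma word_prod_carrier:
  assumes "mat_family N d W" "set is \<subseteq> {1..N}"
  shows "word_prod d W is \<in> carrier_mat d d"
  using assms(2)
proof (induction "is")
  case (Cons i js)
  then have "W i \<in> carrier_mat d d" using assms(1) by (auto simp: mat_family_def)
  with Cons show ?case by auto
qed simp

lemma word_prod_smult:
  assumes W: "mat_family N d W" and "set is \<subseteq> {1..N}"
  shows "word_prod d (\<lambda>i. c \<cdot>\<^sub>m W i) is = c ^ length is \<cdot>\<^sub>m word_prod d W is"
  using assms(2)
proof (induction "is")
  case (Cons i js)
  then have Wi: "W i \<in> carrier_mat d d" and js: "word_prod d W js \<in> carrier_mat d d"
    using W word_prod_carrier[OF W] by (auto simp: mat_family_def)
  have "word_prod d (\<lambda>i. c \<cdot>\<^sub>m W i) (i # js) = (c ^ length js \<cdot>\<^sub>m word_prod d W js) * (c \<cdot>\<^sub>m W i)"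
    using Cons by simp
  also have "\<dots> = c \<cdot>\<^sub>m (c ^ length js \<cdot>\<^sub>m (word_prod d W js * W i))"
    using js Wi by (simp add: mult_smult_distrib[of _ d d] mult_smult_assoc_mat[of _ d d])
  also have "\<dots> = c ^ length (i # js) \<cdot>\<^sub>m word_prod d W (i # js)"
    by (intro eq_matI) auto
  finally show ?case .
qed (auto intro: eq_matI)

text \<open>The empty word gives the full identity, which for \<open>k > 0\<close> is not the
  padding of the smaller one. A padded right factor \<open>X\<close> absorbs the difference and
  makes the induction start at the empty word.\<close>

lemma word_prod_zero_pad_mult:
  assumes W: "mat_family N d W" and "set is \<subseteq> {1..N}" and "X \<in> carrier_mat d d"
  shows "word_prod (d + k) (\<lambda>i. zero_pad k (W i)) is * zero_pad k X = zero_pad k (word_prod d W is * X)"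
  using assms(2,3)
proof (induction "is" arbitrary: X)
  case Nil
  then show ?case using left_mult_one_mat[OF zero_pad_carrier[OF Nil(2), of k]] by simp
next
  case (Cons i js)
  let ?p = "zero_pad k"
  have Wi: "W i \<in> carrier_mat d d" and js: "word_prod d W js \<in> carrier_mat d d"
    using Cons.prems W word_prod_carrier[OF W] by (auto simp: mat_family_def)
  have "mat_family N (d + k) (\<lambda>i. ?p (W i))" using W by (simp add: mat_family_def)
  from word_prod_carrier[OF this, of js] Cons.prems
  have "word_prod (d + k) (\<lambda>i. ?p (W i)) js \<in> carrier_mat (d + k) (d + k)" by simp
  then have "word_prod (d + k) (\<lambda>i. ?p (W i)) (i # js) * ?p X
    = word_prod (d + k) (\<lambda>i. ?p (W i)) js * (?p (W i) * ?p X)"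
    using assoc_mult_mat[OF _ zero_pad_carrier[OF Wi] zero_pad_carrier[OF Cons.prems(2)]] by simp
  also have "?p (W i) * ?p X = ?p (W i * X)" using Wi Cons.prems by (simp add: zero_pad_mult)
  also have "word_prod (d + k) (\<lambda>i. ?p (W i)) js * ?p (W i * X) = ?p (word_prod d W js * (W i * X))"
    using Cons Wi by simp
  also have "word_prod d W js * (W i * X) = word_prod d W (i # js) * X"
    using js Wi Cons.prems by simp
  finally show ?case .
qed

lemma word_prod_zero_pad:
  assumes W: "mat_family N d W" and "set is \<subseteq> {1..N}" "is \<noteq> []"
  shows "word_prod (d + k) (\<lambda>i. zero_pad k (W i)) is = zero_pad k (word_prod d W is)"
proof (cases "is")
  case (Cons i js)
  then show ?thesis
    \<comment> \<open>The first letter of the nonempty word, which is the rightmost factor, serves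
      as \<open>X\<close>.\<close>
    using word_prod_zero_pad_mult[OF W, of js "W i" k] assms by (simp add: mat_family_def)
qed (use assms in simp)

text \<open>The two sequences agree term by term: for positive length by the invariance of the
  largest singular value, and for length 0 because \<open>root 0\<close> is 0 whatever its
  argument.\<close>

lemma joint_spectral_radius_zero_pad:
  assumes W: "mat_family N d W" and d: "d > 0"
  shows "joint_spectral_radius N (d + k) (\<lambda>i. zero_pad k (W i)) = joint_spectral_radius N d W"
proof -
  have "root l (max_singular_value (word_prod (d + k) (\<lambda>i. zero_pad k (W i)) is))
      = root l (max_singular_value (word_prod d W is))" if "is \<in> words N l" for l "is"
  proof (cases "l = 0")
    case False
    then have "is \<noteq> []" "set is \<subseteq> {1..N}" using that by (auto simp: words_def)
    then show ?thesis
      by (simp add: word_prod_zero_pad[OF W] max_singular_value_zero_pad[OF word_prod_carrier[OF W] d])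
  qed simp
  then show ?thesis unfolding joint_spectral_radius_words by (simp cong: image_cong)
qed

text \<open>A product of \<open>k\<close> factors scales by \<open>c ^ k\<close>, the root turns
  this into \<open>c\<close>, and a positive factor passes through the maximum and the limit
  superior. This allows a family to be normalized to radius 1.\<close>

lemma joint_spectral_radius_smult:
  assumes W: "mat_family N d W" and d: "d > 0" and N: "N \<ge> 1" and c: "c > 0"
  shows "joint_spectral_radius N d (\<lambda>i. c \<cdot>\<^sub>m W i) = ereal c * joint_spectral_radius N d W"
proof -
  let ?f = "\<lambda>k is. root k (max_singular_value (word_prod d W is))"
  have "(MAX is\<in>words N k. root k (max_singular_value (word_prod d (\<lambda>i. c \<cdot>\<^sub>m W i) is)))
      = c * (MAX is\<in>words N k. ?f k is)" for k
  proof -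
    have "root k (max_singular_value (word_prod d (\<lambda>i. c \<cdot>\<^sub>m W i) is)) = c * ?f k is"
      if "is \<in> words N k" for "is"
    proof (cases "k = 0")
      case False
      have "length is = k" "set is \<subseteq> {1..N}" using that by (auto simp: words_def)
      then show ?thesis
        using c False
        by (simp add: word_prod_smult[OF W] max_singular_value_smult[OF word_prod_carrier[OF W] d]
            real_root_mult real_root_power_cancel)
    qed simp
    then have "(\<lambda>is. root k (max_singular_value (word_prod d (\<lambda>i. c \<cdot>\<^sub>m W i) is))) ` words N k
        = (*) c ` ?f k ` words N k"
      by (auto simp: image_image)
    moreover have "mono ((*) c)" using c by (simp add: mono_def)
    ultimately show ?thesis
      using mono_Max_commute[of "(*) c" "?f k ` words N k"] finite_words[of N k] words_nonempty[OF N, of k]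
      by simp
  qed
  then show ?thesis
    unfolding joint_spectral_radius_words using c
    by (simp add: limsup_ereal_mult_left flip: times_ereal.simps(1))
qed

lemma word_prod_1x1:
  "word_prod 1 (\<lambda>i. mat 1 1 (\<lambda>_. w i)) is = mat 1 1 (\<lambda>_. prod_list (map w is))"
proof (induction "is")
  case (Cons i js)
  then show ?case by (auto intro!: eq_matI simp: scalar_prod_def)
qed (auto intro: eq_matI)

text \<open>Every product of weights has modulus at most 1, and the word that repeats
  \<open>j\<close> has modulus exactly 1, so the maximum is 1 at each positive length.\<close>

lemma joint_spectral_radius_1x1:
  assumes le: "\<And>i. i \<in> {1..N} \<Longrightarrow> \<bar>w i\<bar> \<le> 1" and j: "j \<in> {1..N}" "\<bar>w j\<bar> = 1"
  shows "joint_spectral_radius N 1 (\<lambda>i. mat 1 1 (\<lambda>_. w i)) = 1"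
proof -
  let ?f = "\<lambda>k is. root k (max_singular_value (word_prod 1 (\<lambda>i. mat 1 1 (\<lambda>_. w i)) is))"
  have f: "?f k is = root k \<bar>prod_list (map w is)\<bar>" for k "is"
    unfolding word_prod_1x1 max_singular_value_1x1 ..
  have "(MAX is\<in>words N k. ?f k is) = 1" if k: "k > 0" for k
  proof (rule Max_eqI)
    show "finite (?f k ` words N k)" using finite_words by simp
    show "1 \<in> ?f k ` words N k"
    proof (rule image_eqI)
      show "replicate k j \<in> words N k" using j by (auto simp: words_def)
      show "1 = ?f k (replicate k j)"
        unfolding f using j k by (simp add: prod_list_replicate power_abs)
    qed
    fix y assume "y \<in> ?f k ` words N k"
    then obtain "is" where "is": "is \<in> words N k" "y = root k \<bar>prod_list (map w is)\<bar>"
      unfolding f by auto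
    have "\<bar>prod_list (map w js)\<bar> \<le> 1" if "set js \<subseteq> {1..N}" for js
      using that by (induction js) (auto simp: abs_mult intro!: mult_le_one le)
    then show "y \<le> 1" using "is" k by (simp add: words_def)
  qed
  \<comment> \<open>At \<open>k = 0\<close> the term is 0 instead of 1, hence the equation holds
    only eventually.\<close>
  then have "eventually (\<lambda>k. ereal (MAX is\<in>words N k. ?f k is) = 1) sequentially"
    unfolding one_ereal_def by (intro eventually_mono[OF eventually_gt_at_top[of 0]]) (simp only:)
  then show ?thesis
    unfolding joint_spectral_radius_words
    by (intro lim_imp_Limsup tendsto_eventually) (rule sequentially_bot)
qed

section \<open>Lower bounds\<close>

lemma mat_sum_carrier [simp]: "mat_sum d f I \<in> carrier_mat d d"
  unfolding mat_sum_def by simp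

lemma mat_sum_smult:
  assumes "\<And>i. i \<in> I \<Longrightarrow> f i \<in> carrier_mat d d"
  shows "mat_sum d (\<lambda>i. c \<cdot>\<^sub>m f i) I = c \<cdot>\<^sub>m mat_sum d f I"
  unfolding mat_sum_def using assms
  by (intro eq_matI) (auto simp: sum_distrib_left carrier_matD[OF assms] intro!: sum.cong)

lemma mat_sum_cong: "(\<And>i. i \<in> I \<Longrightarrow> f i = g i) \<Longrightarrow> mat_sum d f I = mat_sum d g I"
  unfolding mat_sum_def by (intro eq_matI) auto

lemma kronecker_carrier [simp]:
  "A \<in> carrier_mat d d \<Longrightarrow> B \<in> carrier_mat n n \<Longrightarrow> kronecker A B \<in> carrier_mat (d * n) (d * n)"
  unfolding kronecker_def by auto

lemma kronecker_smult:
  assumes "A \<in> carrier_mat d d" "B \<in> carrier_mat n n"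
  shows "kronecker (c \<cdot>\<^sub>m A) B = c \<cdot>\<^sub>m kronecker A B"
  unfolding kronecker_def using assms by (intro eq_matI) (auto simp: less_mult_imp_div_less)

lemma kronecker_1x1: "B \<in> carrier_mat n n \<Longrightarrow> kronecker (mat 1 1 (\<lambda>_. x)) B = x \<cdot>\<^sub>m B"
  unfolding kronecker_def by (intro eq_matI) auto

text \<open>The left factor selects the block, and \<open>r div n < d\<close> amounts to
  \<open>r < d * n\<close>. Padding it therefore appends all new zeros at the end, without any
  permutation of the indices.\<close>

lemma kronecker_zero_pad:
  assumes A: "A \<in> carrier_mat d d" and B: "B \<in> carrier_mat n n" and n: "n > 0"
  shows "kronecker (zero_pad k A) B = zero_pad (k * n) (kronecker A B)"
proof (rule eq_matI)
  let ?K = "zero_pad (k * n) (kronecker A B)"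
  have K: "?K \<in> carrier_mat (d * n + k * n) (d * n + k * n)" using A B by simp
  have P: "zero_pad k A \<in> carrier_mat (d + k) (d + k)" using A by simp
  show "dim_row (kronecker (zero_pad k A) B) = dim_row ?K" "dim_col (kronecker (zero_pad k A) B) = dim_col ?K"
    using K P B by (auto simp: kronecker_def algebra_simps)
  fix r c assume rc: "r < dim_row ?K" "c < dim_col ?K"
  then have rc: "r < (d + k) * n" "c < (d + k) * n" using K by (auto simp: algebra_simps)
  then have "r div n < d + k" "c div n < d + k" by (auto simp: less_mult_imp_div_less)
  then have "kronecker (zero_pad k A) B $$ (r, c)
    = (if r < d * n \<and> c < d * n then A $$ (r div n, c div n) else 0) * B $$ (r mod n, c mod n)"
    using rc n
    by (simp add: kronecker_def index_zero_pad[OF A] carrier_matD[OF P] carrier_matD[OF B] div_less_iff_less_mult)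
  also have "\<dots> = ?K $$ (r, c)"
    using rc A B by (subst index_zero_pad[of _ "d * n"]) (auto simp: kronecker_def algebra_simps)
  finally show "kronecker (zero_pad k A) B $$ (r, c) = ?K $$ (r, c)" .
qed

lemma mat_sum_zero_pad:
  assumes "\<And>i. i \<in> I \<Longrightarrow> f i \<in> carrier_mat d d"
  shows "mat_sum (d + k) (\<lambda>i. zero_pad k (f i)) I = zero_pad k (mat_sum d f I)"
proof (rule eq_matI)
  have P: "zero_pad k (mat_sum d f I) \<in> carrier_mat (d + k) (d + k)" by simp
  show "dim_row (mat_sum (d + k) (\<lambda>i. zero_pad k (f i)) I) = dim_row (zero_pad k (mat_sum d f I))"
    "dim_col (mat_sum (d + k) (\<lambda>i. zero_pad k (f i)) I) = dim_col (zero_pad k (mat_sum d f I))"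
    by (simp_all only: carrier_matD[OF P] carrier_matD[OF mat_sum_carrier])
  fix r c assume "r < dim_row (zero_pad k (mat_sum d f I))" "c < dim_col (zero_pad k (mat_sum d f I))"
  then have rc: "r < d + k" "c < d + k" using P by auto
  then show "mat_sum (d + k) (\<lambda>i. zero_pad k (f i)) I $$ (r, c) = zero_pad k (mat_sum d f I) $$ (r, c)"
    using assms by (subst index_zero_pad[of _ d]) (auto simp: mat_sum_def index_zero_pad[of _ d])
qed

lemma zero_pad_smult: "c \<cdot>\<^sub>m zero_pad k A = zero_pad k (c \<cdot>\<^sub>m (A :: 'a :: mult_zero mat))"
  unfolding zero_pad_def by (intro eq_matI) auto

section \<open>Monotonicity in the size of the weights, and particular choices of weights\<close>

lemma ell_ge:
  assumes "mat_family N m W" "joint_spectral_radius N m W = 1"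
  shows "ereal (rho ((1 / real N) \<cdot>\<^sub>m mat_sum (m * n) (\<lambda>i. kronecker (W i) (A i)) {1..N})) \<le> ell N n A m"
  unfolding ell_def using assms by (intro Sup_upper) blast

text \<open>Each competitor of size \<open>d\<close> becomes, after padding, a competitor of size
  \<open>m\<close> whose spectral radius is at least as large.\<close>

lemma ell_mono:
  assumes A: "mat_family N n A" and n: "n > 0" and d: "d > 0" and le: "d \<le> m"
  shows "ell N n A d \<le> ell N n A m"
proof -
  obtain k where m: "m = d + k" using le le_Suc_ex by blast
  let ?S = "\<lambda>d W. (1 / real N) \<cdot>\<^sub>m mat_sum (d * n) (\<lambda>i. kronecker (W i) (A i)) {1..N}"
  have "ereal (rho (?S d W)) \<le> ell N n A m"
    if W: "mat_family N d W" and j: "joint_spectral_radius N d W = 1" for W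
  proof -
    have fam: "mat_family N m (\<lambda>i. zero_pad k (W i))" using W by (simp add: mat_family_def m)
    have "mat_sum (m * n) (\<lambda>i. kronecker (zero_pad k (W i)) (A i)) {1..N}
        = mat_sum (d * n + k * n) (\<lambda>i. zero_pad (k * n) (kronecker (W i) (A i))) {1..N}"
      using W A n unfolding m add_mult_distrib
      by (intro mat_sum_cong kronecker_zero_pad[of _ d _ n]) (auto simp: mat_family_def)
    also have "\<dots> = zero_pad (k * n) (mat_sum (d * n) (\<lambda>i. kronecker (W i) (A i)) {1..N})"
      using W A by (intro mat_sum_zero_pad) (simp add: mat_family_def)
    finally have "?S m (\<lambda>i. zero_pad k (W i)) = zero_pad (k * n) (?S d W)"
      by (simp add: zero_pad_smult)
    then have "rho (?S d W) \<le> rho (?S m (\<lambda>i. zero_pad k (W i)))"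
      using rho_le_rho_zero_pad[of "?S d W" "d * n"] n d by simp
    also have "ereal (rho (?S m (\<lambda>i. zero_pad k (W i)))) \<le> ell N n A m"
      using joint_spectral_radius_zero_pad[OF W d, of k] j by (intro ell_ge[OF fam]) (simp add: m)
    finally show ?thesis by simp
  qed
  then show ?thesis unfolding ell_def[of N n A d] by (auto intro!: Sup_least)
qed

lemma ell_1_ge:
  assumes A: "mat_family N n A"
    and le: "\<And>i. i \<in> {1..N} \<Longrightarrow> \<bar>w i\<bar> \<le> 1" and j: "j \<in> {1..N}" "\<bar>w j\<bar> = 1"
  shows "ereal (rho ((1 / real N) \<cdot>\<^sub>m mat_sum n (\<lambda>i. w i \<cdot>\<^sub>m A i) {1..N})) \<le> ell N n A 1"
proof -
  have "mat_sum n (\<lambda>i. w i \<cdot>\<^sub>m A i) {1..N}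
      = mat_sum (1 * n) (\<lambda>i. kronecker (mat 1 1 (\<lambda>_. w i)) (A i)) {1..N}"
    using A by (auto intro!: mat_sum_cong simp: kronecker_1x1[of _ n, unfolded One_nat_def] mat_family_def)
  moreover have "mat_family N 1 (\<lambda>i. mat 1 1 (\<lambda>_. w i))" by (simp add: mat_family_def)
  ultimately show ?thesis
    using ell_ge[OF _ joint_spectral_radius_1x1[of N w j, OF le j], of n A] by simp
qed

text \<open>The supremum of an empty set of extended reals would be \<open>-\<infinity>\<close>. The
  constant weight 1 is an admissible competitor, and a spectral radius is nonnegative.\<close>

lemma ell_nonneg:
  assumes "mat_family N n A" "N \<ge> 1" "n > 0"
  shows "0 \<le> ell N n A 1"
proof -
  have "0 \<le> rho ((1 / real N) \<cdot>\<^sub>m mat_sum n (\<lambda>i. 1 \<cdot>\<^sub>m A i) {1..N})"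
    using assms by (intro rho_nonneg[of _ n]) auto
  also have "ereal \<dots> \<le> ell N n A 1"
    using assms by (intro ell_1_ge[of _ _ _ "\<lambda>_. 1" 1]) auto
  finally show ?thesis by (simp add: zero_ereal_def)
qed

text \<open>If the joint spectral radius is a real number \<open>r\<close>, the family
  \<open>A\<close> divided by \<open>r\<close> is admissible, and its value is exactly
  \<open>ell_Z\<close>.\<close>

lemma ell_Z_le_ell:
  assumes A: "mat_family N n A" and N: "N \<ge> 1" and n: "n > 0" and pos: "joint_spectral_radius N n A > 0"
  shows "ell_Z N n A \<le> ell N n A n"
proof (cases "joint_spectral_radius N n A")
  case (real r)
  then have r: "r > 0" using pos by simp
  let ?K = "mat_sum (n * n) (\<lambda>i. kronecker (A i) (A i)) {1..N}"
  let ?W = "\<lambda>i. (1 / r) \<cdot>\<^sub>m A i"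
  have "mat_sum (n * n) (\<lambda>i. kronecker (?W i) (A i)) {1..N}
      = mat_sum (n * n) (\<lambda>i. (1 / r) \<cdot>\<^sub>m kronecker (A i) (A i)) {1..N}"
    using A by (intro mat_sum_cong kronecker_smult[of _ n _ n]) (auto simp: mat_family_def)
  also have "\<dots> = (1 / r) \<cdot>\<^sub>m ?K"
    using A by (intro mat_sum_smult) (simp add: mat_family_def)
  finally have "rho ((1 / real N) \<cdot>\<^sub>m mat_sum (n * n) (\<lambda>i. kronecker (?W i) (A i)) {1..N})
      = 1 / real N * (1 / r * rho ?K)"
    using N n r by (simp add: rho_smult[of _ "n * n"])
  moreover have "joint_spectral_radius N n ?W = 1"
    using joint_spectral_radius_smult[OF A n N, of "1 / r"] r real by (simp add: one_ereal_def)
  moreover have "mat_family N n ?W" using A by (simp add: mat_family_def)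
  ultimately have "ereal (1 / real N * (1 / r * rho ?K)) \<le> ell N n A n"
    using ell_ge[of N n ?W n A] by simp
  then show ?thesis using N r by (simp add: ell_Z_def real ac_simps)
next
  \<comment> \<open>In fact impossible; the convention \<open>x / \<infinity> = 0\<close> spares a proof of finiteness.\<close>
  case PInf
  then have "ell_Z N n A = 0" using N by (simp add: ell_Z_def)
  also have "0 \<le> ell N n A 1" using ell_nonneg[OF A N n] .
  also have "\<dots> \<le> ell N n A n" using ell_mono[OF A n] n by simp
  finally show ?thesis .
next
  case MInf
  then show ?thesis using pos by simp
qed


section \<open>Existence of the maximum\<close>

text \<open>By the Leibniz formula the determinant is a polynomial in the entries.\<close>

lemma continuous_on_det:
  fixes M :: "'b :: topological_space \<Rightarrow> 'a :: real_normed_field mat"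
  assumes M: "\<And>x. M x \<in> carrier_mat d d"
    and cont: "\<And>i j. i < d \<Longrightarrow> j < d \<Longrightarrow> continuous_on S (\<lambda>x. M x $$ (i, j))"
  shows "continuous_on S (\<lambda>x. det (M x))"
  unfolding det_def'[OF M]
  by (intro continuous_on_sum continuous_on_mult continuous_on_const continuous_on_prod cont)
    (auto simp: permutes_in_image)

text \<open>The pairs of a parameter and an eigenvalue form a compact set, on which the modulus of the
  eigenvalue attains its maximum. This avoids proving continuity of the spectral radius.\<close>

lemma rho_attains_sup:
  fixes M :: "'b :: topological_space \<Rightarrow> real mat"
  assumes M: "\<And>x. M x \<in> carrier_mat d d" and d: "d > 0"
    and cont: "\<And>i j. i < d \<Longrightarrow> j < d \<Longrightarrow> continuous_on UNIV (\<lambda>x. M x $$ (i, j))"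
    and S: "compact S" "S \<noteq> {}"
  shows "\<exists>x\<in>S. \<forall>y\<in>S. rho (M y) \<le> rho (M x)"
proof -
  let ?C = "map_mat complex_of_real"
  \<comment> \<open>This single continuous function dominates every entry, so its maximum over
    \<open>S\<close> bounds all entries at once.\<close>
  define s where "s x = (\<Sum>i<d. \<Sum>j<d. \<bar>M x $$ (i, j)\<bar>)" for x
  have "continuous_on S s"
    unfolding s_def
    by (intro continuous_on_sum continuous_on_rabs continuous_on_subset[OF cont]) auto
  then obtain x0 where x0: "\<And>x. x \<in> S \<Longrightarrow> s x \<le> s x0"
    using continuous_attains_sup[OF S] by blast
  \<comment> \<open>A compact square in the complex plane. By \<open>eigenvalue_norm_le\<close> its
    half side \<open>real d * s x0\<close> is large enough for every eigenvalue of every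
    \<open>M x\<close> with \<open>x\<close> in \<open>S\<close>.\<close>
  define Q where "Q = (\<lambda>(a, b). complex_of_real a + \<i> * complex_of_real b) `
    ({- (real d * s x0)..real d * s x0} \<times> {- (real d * s x0)..real d * s x0})"
  have "compact Q"
    unfolding Q_def by (intro compact_continuous_image compact_Times compact_Icc)
      (auto simp: case_prod_unfold intro!: continuous_intros)
  have Q_mem: "e \<in> Q" if "cmod e \<le> real d * s x0" for e
  proof -
    have "\<bar>Re e\<bar> \<le> real d * s x0" "\<bar>Im e\<bar> \<le> real d * s x0"
      using that abs_Re_le_cmod[of e] abs_Im_le_cmod[of e] by linarith+
    then show ?thesis
      unfolding Q_def by (intro image_eqI[of _ _ "(Re e, Im e)"]) (auto simp: complex_eq)
  qed
  \<comment> \<open>The eigenvalue condition is written as a vanishing determinant, which is closed;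
    the factor \<open>Q\<close> gives compactness and, by the next fact, cuts off no
    eigenvalue.\<close>
  define K where "K = (S \<times> Q) \<inter> {p. det (char_matrix (?C (M (fst p))) (snd p)) = 0}"
  have CM: "?C (M x) \<in> carrier_mat d d" for x using M by simp
  have K_iff: "(x, e) \<in> K \<longleftrightarrow> x \<in> S \<and> eigenvalue (?C (M x)) e" for x e
  proof -
    have "cmod e \<le> real d * s x0" if x: "x \<in> S" and e: "eigenvalue (?C (M x)) e"
    proof (rule eigenvalue_norm_le[OF CM _ e])
      fix i j assume ij: "i < d" "j < d"
      have "\<bar>M x $$ (i, j)\<bar> \<le> (\<Sum>j<d. \<bar>M x $$ (i, j)\<bar>)"
        using ij by (intro member_le_sum) auto
      also have "\<dots> \<le> s x"
        unfolding s_def using ij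
        by (intro member_le_sum[of i _ "\<lambda>i. \<Sum>j<d. \<bar>M x $$ (i, j)\<bar>"]) (auto intro: sum_nonneg)
      finally show "cmod (?C (M x) $$ (i, j)) \<le> s x0"
        using x0[OF x] ij M[of x] by simp
    qed
    then show ?thesis unfolding K_def by (auto simp: eigenvalue_det[OF CM] Q_mem)
  qed
  have "continuous_on UNIV (\<lambda>p. det (char_matrix (?C (M (fst p))) (snd p)))"
  proof (rule continuous_on_det)
    show "char_matrix (?C (M (fst p))) (snd p) \<in> carrier_mat d d" for p :: "'b \<times> complex"
      using CM by simp
    fix i j assume ij: "i < d" "j < d"
    have "char_matrix (?C (M (fst p))) (snd p) $$ (i, j)
      = of_real (M (fst p) $$ (i, j)) + (- snd p) * (if i = j then 1 else 0)" for p :: "'b \<times> complex"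
      unfolding char_matrix_def using ij carrier_matD[OF M[of "fst p"]] by simp
    moreover have "continuous_on UNIV (\<lambda>p :: 'b \<times> complex. M (fst p) $$ (i, j))"
      using continuous_on_compose2[OF cont[OF ij], of UNIV fst] by (simp add: continuous_on_fst)
    ultimately show "continuous_on UNIV (\<lambda>p. char_matrix (?C (M (fst p))) (snd p) $$ (i, j))"
      by (auto intro!: continuous_intros)
  qed
  then have "closed {p. det (char_matrix (?C (M (fst p))) (snd p)) = 0}"
    by (intro closed_Collect_eq continuous_on_const)
  then have "compact K"
    unfolding K_def using S \<open>compact Q\<close> by (intro compact_Int_closed compact_Times)
  moreover have "K \<noteq> {}"
  proof -
    obtain x where x: "x \<in> S" using S by blast
    obtain e where "eigenvalue (?C (M x)) e" using rho_attained[OF M d] .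
    with x have "(x, e) \<in> K" by (simp add: K_iff)
    then show ?thesis by blast
  qed
  moreover have "continuous_on K (\<lambda>p. cmod (snd p))" by (intro continuous_intros)
  ultimately obtain p where p: "p \<in> K" "\<And>q. q \<in> K \<Longrightarrow> cmod (snd q) \<le> cmod (snd p)"
    using continuous_attains_sup[of K "\<lambda>p. cmod (snd p)"] by blast
  obtain x e where xe: "p = (x, e)" by (cases p)
  have x: "x \<in> S" "eigenvalue (?C (M x)) e" using p(1) by (auto simp: xe K_iff)
  \<comment> \<open>An eigenvalue of \<open>M y\<close> of largest modulus is the second component
    of a pair in \<open>K\<close>, hence dominated by \<open>e\<close>.\<close>
  have "rho (M y) \<le> rho (M x)" if y: "y \<in> S" for y
  proof -
    obtain f where f: "eigenvalue (?C (M y)) f" "cmod f = rho (M y)" using rho_attained[OF M d] .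
    then have "rho (M y) \<le> cmod e" using p(2)[of "(y, f)"] y by (simp add: K_iff xe)
    also have "\<dots> \<le> rho (M x)" using rho_ge[OF M x(2)] .
    finally show ?thesis .
  qed
  with x show ?thesis by blast
qed

text \<open>\<open>GREATEST\<close> yields information only once a largest value is exhibited;
  compactness of the box supplies one.\<close>

lemma ell_box_attained:
  assumes A: "mat_family N n A" and n: "n > 0"
  obtains w where "\<And>i. i \<in> {1..N} \<Longrightarrow> \<bar>w i\<bar> \<le> 1"
    "ell_box N n A = rho ((1 / real N) \<cdot>\<^sub>m mat_sum n (\<lambda>i. w i \<cdot>\<^sub>m A i) {1..N})"
proof -
  let ?M = "\<lambda>w :: nat \<Rightarrow> real. (1 / real N) \<cdot>\<^sub>m mat_sum n (\<lambda>i. w i \<cdot>\<^sub>m A i) {1..N}"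
  \<comment> \<open>The cube constrains the coordinates at all natural numbers, so that it is
    compact in the product topology by Tychonoff's theorem.\<close>
  define S :: "(nat \<Rightarrow> real) set" where "S = (\<Pi>\<^sub>E i\<in>UNIV. {-1..1})"
  have "compact S"
    using compactin_PiE[of "\<lambda>_. euclideanreal" UNIV "\<lambda>_. {-1..1}"]
    unfolding S_def euclidean_product_topology by simp
  moreover have "(\<lambda>_. 0) \<in> S" by (auto simp: S_def PiE_iff)
  then have "S \<noteq> {}" by blast
  moreover have "continuous_on UNIV (\<lambda>w. ?M w $$ (r, c))" if rc: "r < n" "c < n" for r c
  proof -
    have "?M w $$ (r, c) = 1 / real N * (\<Sum>i=1..N. w i * A i $$ (r, c))" for w
      using A rc by (auto simp: mat_sum_def mat_family_def intro!: sum.cong)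
    moreover have "continuous_on UNIV (\<lambda>w :: nat \<Rightarrow> real. 1 / real N * (\<Sum>i=1..N. w i * A i $$ (r, c)))"
      by (intro continuous_on_mult continuous_on_sum continuous_on_const continuous_on_product_coordinates)
    ultimately show ?thesis by simp
  qed
  ultimately obtain w where w: "w \<in> S" "\<And>v. v \<in> S \<Longrightarrow> rho (?M v) \<le> rho (?M w)"
    using rho_attains_sup[of ?M n S] n by (auto simp del: index_smult_mat)
  have "ell_box N n A = rho (?M w)"
    unfolding ell_box_def
  proof (rule Greatest_equality)
    show "\<exists>v. (\<forall>i\<in>{1..N}. v i \<in> {-1..1}) \<and> rho (?M w) = rho (?M v)"
      using w(1) by (auto simp: S_def PiE_iff)
    fix y assume "\<exists>v. (\<forall>i\<in>{1..N}. v i \<in> {-1..1}) \<and> y = rho (?M v)"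
    then obtain v where v: "\<forall>i\<in>{1..N}. v i \<in> {-1..1}" "y = rho (?M v)" by blast
    \<comment> \<open>The weights \<open>v\<close> are arbitrary outside \<open>{1..N}\<close>.
      Setting them to 0 there puts them into \<open>S\<close> without changing the matrix.\<close>
    let ?v = "\<lambda>i. if i \<in> {1..N} then v i else 0"
    have "mat_sum n (\<lambda>i. v i \<cdot>\<^sub>m A i) {1..N} = mat_sum n (\<lambda>i. ?v i \<cdot>\<^sub>m A i) {1..N}"
      by (intro mat_sum_cong) simp
    moreover have "?v \<in> S" using v(1) by (auto simp: S_def)
    ultimately show "y \<le> rho (?M w)" using w(2)[of ?v] v(2) by simp
  qed
  moreover have "\<bar>w i\<bar> \<le> 1" for i using w(1) by (auto simp: S_def PiE_iff abs_le_iff)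
  ultimately show thesis using that by blast
qed

text \<open>A maximizer \<open>w\<close> may have all moduli below 1 and then is not admissible as a
  family of size 1. Dividing by the largest modulus \<open>c\<close> makes it admissible and, since
  \<open>c \<le> 1\<close>, does not decrease the spectral radius.\<close>

lemma ell_box_le_ell_1:
  assumes A: "mat_family N n A" and N: "N \<ge> 1" and n: "n > 0"
  shows "ereal (ell_box N n A) \<le> ell N n A 1"
proof -
  let ?M = "\<lambda>w :: nat \<Rightarrow> real. (1 / real N) \<cdot>\<^sub>m mat_sum n (\<lambda>i. w i \<cdot>\<^sub>m A i) {1..N}"
  obtain w where w: "\<And>i. i \<in> {1..N} \<Longrightarrow> \<bar>w i\<bar> \<le> 1" "ell_box N n A = rho (?M w)"
    using ell_box_attained[OF A n] by blast
  define c where "c = (MAX i\<in>{1..N}. \<bar>w i\<bar>)"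
  have c_ge: "\<bar>w i\<bar> \<le> c" if "i \<in> {1..N}" for i
    unfolding c_def using that by (intro Max_ge) auto
  have "c \<in> (\<lambda>i. \<bar>w i\<bar>) ` {1..N}" unfolding c_def using N by (intro Max_in) auto
  then obtain j where j: "j \<in> {1..N}" "\<bar>w j\<bar> = c" by auto
  show ?thesis
  proof (cases "c = 0")
    \<comment> \<open>No rescaling is possible here, but all weights vanish, so the value is the
      spectral radius of the zero matrix and \<open>ell_nonneg\<close> suffices.\<close>
    case True
    have "w i = 0 \<and> dim_row (A i) = n \<and> dim_col (A i) = n" if "i \<in> {1..N}" for i
      using c_ge[OF that] True A that by (auto simp: mat_family_def)
    then have "?M w = 0\<^sub>m n n"
      by (auto simp: mat_sum_def intro!: eq_matI sum.neutral)
    moreover have "rho (0\<^sub>m n n) \<le> 0"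
    proof -
      obtain e where e: "eigenvalue (map_mat complex_of_real (0\<^sub>m n n)) e" "cmod e = rho (0\<^sub>m n n)"
        using rho_attained[of "0\<^sub>m n n" n] n by auto
      with eigenvalue_norm_le[of "map_mat complex_of_real (0\<^sub>m n n)" n 0 e] show ?thesis by simp
    qed
    ultimately have "ereal (ell_box N n A) \<le> 0" using w by simp
    then show ?thesis using ell_nonneg[OF A N n] by (rule order_trans)
  next
    case False
    then have c: "0 < c" "c \<le> 1" using j w(1)[of j] by auto
    have "?M w = c \<cdot>\<^sub>m ?M (\<lambda>i. w i / c)"
    proof -
      have "mat_sum n (\<lambda>i. w i \<cdot>\<^sub>m A i) {1..N} = mat_sum n (\<lambda>i. c \<cdot>\<^sub>m ((w i / c) \<cdot>\<^sub>m A i)) {1..N}"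
        using c by (intro mat_sum_cong eq_matI) auto
      also have "\<dots> = c \<cdot>\<^sub>m mat_sum n (\<lambda>i. (w i / c) \<cdot>\<^sub>m A i) {1..N}"
        using A by (intro mat_sum_smult) (simp add: mat_family_def)
      finally show ?thesis by (auto intro!: eq_matI)
    qed
    then have "rho (?M w) = c * rho (?M (\<lambda>i. w i / c))"
      using n c by (simp add: rho_smult[of _ n])
    also have "\<dots> \<le> rho (?M (\<lambda>i. w i / c))"
      using n c by (intro mult_left_le_one_le rho_nonneg[of _ n]) auto
    also have "ereal \<dots> \<le> ell N n A 1"
      using c c_ge j by (intro ell_1_ge[OF A, of _ j]) auto
    finally show ?thesis using w by simp
  qed
qed

theorem theorem5:
  fixes N n :: nat and A :: "nat \<Rightarrow> real mat"
  assumes "N \<ge> 1" and "n \<ge> 1" and "mat_family N n A"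
  shows "(joint_spectral_radius N n A > 0 \<longrightarrow> (\<forall>m\<ge>n. ell_Z N n A \<le> ell N n A m))
       \<and> (\<forall>m\<ge>1. ereal (ell_box N n A) \<le> ell N n A m)"
proof (intro conjI impI allI)
  have n: "n > 0" using assms(2) by simp
  fix m
  show "ell_Z N n A \<le> ell N n A m" if "joint_spectral_radius N n A > 0" "n \<le> m"
    using ell_Z_le_ell[OF assms(3,1) n that(1)] ell_mono[OF assms(3) n n that(2)] by (rule order_trans)
  show "ereal (ell_box N n A) \<le> ell N n A m" if "1 \<le> m"
    using ell_box_le_ell_1[OF assms(3,1) n] ell_mono[OF assms(3) n _ that]
    by (auto intro: order_trans)
qed

end
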